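(* Let $N\ge 3$ be an integer and let $f_1(x)=(x-N^{-1})^3$ on $[0,1]$. Let $\gamma_{N,k}$, $k=0,\dots,N$, be the coefficients in $f_1=\sum_{k=0}^N\gamma_{N,k}p_{N,k}$, and let $t_{N,2}=f_1^{-1}(\gamma_{N,2})$, where $f_1^{-1}(y)=N^{-1}+y^{1/3}$ (real cube root) for $y\in\mathbb{R}$. Then $t_{N,2}<0$, so $B_N^{f_1}$ is not well defined; that is, there is no generalized Bernstein operator $C[0,1]\to\mathbb{P}_N[0,1]$ fixing $\mathbf{1}$ and $f_1$.
   Context: $\mathbb{P}_N[0,1]$ is the space of real polynomials of degree at most $N$ on $[0,1]$, with the standard Bernstein basis $p_{N,k}(x)=\binom{N}{k}x^k(1-x)^{N-k}$, $k=0,\dots,N$. A generalized Bernstein operator $B_N:C[0,1]\to\mathbb{P}_N[0,1]$ is an operator of the form $B_Nf=\sum_{k=0}^N f(t_{N,k})\,\alpha_{N,k}\,p_{N,k}$ with nodes $t_{N,0},\dots,t_{N,N}\in[0,1]$ and weights $\alpha_{N,k}>0$. It fixes $g$ if $B_Ng=g$; $\mathbf{1}$ is the constant function $1$. $B_N^{f_1}$ denotes the (unique if it exists) generalized Bernstein operator fixing $\mathbf{1}$ and $f_1$; its weights must be $1$ and its nodes must be $t_{N,k}=f_1^{-1}(\gamma_{N,k})$. *)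

theory Defs
  imports "HOL-Analysis.Analysis"
begin

text \<open>
  The basis polynomial $p_{N,k}$ is the library function \<^term>\<open>Bernstein N k\<close>.
  Functions on $[0,1]$ are total functions \<^typ>\<open>real \<Rightarrow> real\<close> of which only the values on
  \<^term>\<open>{0..1::real}\<close> matter: membership in $C[0,1]$ is \<^term>\<open>continuous_on {0..1::real} f\<close>, and all
  identities between functions are required on \<^term>\<open>{0..1::real}\<close> only.
\<close>

definition bernstein_expansion :: "nat \<Rightarrow> (real \<Rightarrow> real) \<Rightarrow> (nat \<Rightarrow> real) \<Rightarrow> bool" where
  "bernstein_expansion N f c \<longleftrightarrow> (\<forall>x\<in>{0..1}. f x = (\<Sum>k\<le>N. c k * Bernstein N k x))"

text \<open>
  The coefficient vector is indexed by \<^term>\<open>{..N::nat}\<close>; restricting to \<^const>\<open>extensional\<close> functions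
  makes it unique as a function on all of \<^typ>\<open>nat\<close>.  It is meaningful when \<^term>\<open>f\<close> agrees on
  $[0,1]$ with a polynomial of degree at most \<^term>\<open>N\<close>.
\<close>

definition bernstein_coeff :: "nat \<Rightarrow> (real \<Rightarrow> real) \<Rightarrow> nat \<Rightarrow> real" where
  "bernstein_coeff N f = (THE c. c \<in> extensional {..N} \<and> bernstein_expansion N f c)"

definition generalized_bernstein_operator ::
    "nat \<Rightarrow> ((real \<Rightarrow> real) \<Rightarrow> (real \<Rightarrow> real)) \<Rightarrow> bool" where
  "generalized_bernstein_operator N B \<longleftrightarrow>
     (\<exists>t \<alpha>. (\<forall>k\<le>N. t k \<in> {0..1} \<and> \<alpha> k > 0) \<and>
        (\<forall>f. continuous_on {0..1} f \<longrightarrow>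
           (\<forall>x\<in>{0..1}. B f x = (\<Sum>k\<le>N. f (t k) * \<alpha> k * Bernstein N k x))))"

definition fixes_function :: "((real \<Rightarrow> real) \<Rightarrow> (real \<Rightarrow> real)) \<Rightarrow> (real \<Rightarrow> real) \<Rightarrow> bool" where
  "fixes_function B g \<longleftrightarrow> (\<forall>x\<in>{0..1}. B g x = g x)"

lemma bernstein_sum_eq_0:
  assumes z: "\<forall>x\<in>{0..1}. (\<Sum>k\<le>N. c k * Bernstein N k x) = 0" and "k \<le> N"
  shows "c k = 0"
proof -
  have root: "(\<Sum>k\<le>N. (c k * real (N choose k)) * u ^ k) = 0" if "u > 0" for u :: real
  proof -
    define x where "x = u / (1 + u)"
    have x: "x \<in> {0..1}" and x1: "1 - x = 1 / (1 + u)"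
      using that by (auto simp: x_def field_simps)
    have B: "Bernstein N k x = real (N choose k) * u ^ k / (1 + u) ^ N" if "k \<le> N" for k
    proof -
      have "(1 + u) ^ N = (1 + u) ^ k * (1 + u) ^ (N - k)"
        using that by (simp flip: power_add)
      then show ?thesis
        unfolding Bernstein_def x1 by (simp add: x_def power_divide)
    qed
    have "0 = (\<Sum>k\<le>N. c k * Bernstein N k x)" using z x by simp
    also have "\<dots> = (\<Sum>k\<le>N. (c k * real (N choose k)) * u ^ k) / (1 + u) ^ N"
      unfolding sum_divide_distrib by (rule sum.cong[OF refl]) (simp add: B)
    finally have "(\<Sum>k\<le>N. (c k * real (N choose k)) * u ^ k) / (1 + u) ^ N = 0" by (rule sym)
    moreover have "(1 + u) ^ N \<noteq> 0" using that by simp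
    ultimately show ?thesis by (simp only: divide_eq_0_iff) simp
  qed
  have "infinite {u::real. (\<Sum>k\<le>N. (c k * real (N choose k)) * u ^ k) = 0}"
    by (rule infinite_super[OF _ infinite_Ioi[of "0::real"]]) (use root in blast)
  then have "\<forall>k\<le>N. c k * real (N choose k) = 0"
    using polyfun_finite_roots[of "\<lambda>k. c k * real (N choose k)" N] by auto
  with \<open>k \<le> N\<close> show ?thesis by auto
qed

lemma bernstein_coeff_eqI:
  assumes "bernstein_expansion N f c" "k \<le> N"
  shows "bernstein_coeff N f k = c k"
proof -
  have uniq: "d j = c j" if "bernstein_expansion N f d" "j \<le> N" for d j
  proof -
    have "\<forall>x\<in>{0..1}. (\<Sum>k\<le>N. (d k - c k) * Bernstein N k x) = 0"
      using that(1) assms(1)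
      by (auto simp: bernstein_expansion_def left_diff_distrib sum_subtractf)
    from bernstein_sum_eq_0[OF this that(2)] show ?thesis by simp
  qed
  have "bernstein_coeff N f = restrict c {..N}"
    unfolding bernstein_coeff_def
  proof (rule the_equality)
    show "restrict c {..N} \<in> extensional {..N} \<and> bernstein_expansion N f (restrict c {..N})"
      using assms(1) by (auto simp: bernstein_expansion_def)
    show "d = restrict c {..N}" if "d \<in> extensional {..N} \<and> bernstein_expansion N f d" for d
      using that uniq by (intro extensionalityI[of _ "{..N}"]) auto
  qed
  with \<open>k \<le> N\<close> show ?thesis by simp
qed

end

theory Submission
  imports Defs
begin

text \<open>
  Bernstein coefficients are unique.  An operator fixing the constant $1$ therefore has all weights
  equal to $1$, and if it also fixes a continuous function $g$, then the $k$-th Bernstein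
  coefficient of $g$ is the value of $g$ at the node $t_{N,k} \<in> [0,1]$
  (\<open>generalized_bernstein_operator_nodes\<close>).

  For $f_1(x) = (x - 1/N)^3$ this fails at $k = 2$.  Since $x^j$ has the Bernstein coefficients
  $\binom{k}{j} / \binom{N}{j}$ (\<open>bernstein_expansion_power\<close>), expanding the cube gives
  \[ \gamma_{N,2} = - \frac{6}{N^2(N-1)} + \frac{6}{N^3} - \frac{1}{N^3}
       = - \frac{1}{N^3} \cdot \frac{N+5}{N-1} < - \frac{1}{N^3} = f_1(0). \]
  As the cube is increasing, $\gamma_{N,2}$ lies below every value of $f_1$ on $[0,1]$, and its
  preimage under $f_1$ on the real line is negative.
\<close>

lemma sum_binomial_Bernstein:
  assumes "j \<le> N"
  shows "(\<Sum>k\<le>N. real (k choose j) * Bernstein N k x) = real (N choose j) * x ^ j"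
proof -
  have "(\<Sum>k\<le>N. real (k choose j) * Bernstein N k x)
      = (\<Sum>k\<in>{j..N}. real (k choose j) * Bernstein N k x)"
    by (rule sum.mono_neutral_right) (auto simp: binomial_eq_0)
  also have "\<dots> = (\<Sum>k\<in>{j..N}. real (N choose j) * x ^ j * Bernstein (N - j) (k - j) x)"
  proof (rule sum.cong[OF refl])
    fix k assume k: "k \<in> {j..N}"
    have "real (k choose j) * real (N choose k) = real (N choose j) * real (N - j choose (k - j))"
      using k choose_mult[of j k N] by (simp add: mult.commute flip: of_nat_mult)
    moreover have "x ^ k = x ^ j * x ^ (k - j)" and "N - j - (k - j) = N - k"
      using k by (auto simp flip: power_add)
    ultimately show "real (k choose j) * Bernstein N k x
        = real (N choose j) * x ^ j * Bernstein (N - j) (k - j) x"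
      by (simp add: Bernstein_def)
  qed
  also have "\<dots> = (\<Sum>i\<le>N - j. real (N choose j) * x ^ j * Bernstein (N - j) i x)"
    using assms by (intro sum.reindex_bij_witness[of _ "\<lambda>i. i + j" "\<lambda>k. k - j"]) auto
  also have "\<dots> = real (N choose j) * x ^ j"
    by (simp flip: sum_distrib_left)
  finally show ?thesis .
qed

lemma bernstein_expansion_power:
  assumes "j \<le> N"
  shows "bernstein_expansion N (\<lambda>x. x ^ j) (\<lambda>k. real (k choose j) / real (N choose j))"
  using sum_binomial_Bernstein[OF assms] assms
  by (simp add: bernstein_expansion_def flip: sum_divide_distrib)

lemma bernstein_expansion_add:
  "bernstein_expansion N f c \<Longrightarrow> bernstein_expansion N g d \<Longrightarrow>
    bernstein_expansion N (\<lambda>x. f x + g x) (\<lambda>k. c k + d k)"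
  by (simp add: bernstein_expansion_def distrib_right sum.distrib)

lemma bernstein_expansion_scale:
  "bernstein_expansion N f c \<Longrightarrow> bernstein_expansion N (\<lambda>x. a * f x) (\<lambda>k. a * c k)"
  by (simp add: bernstein_expansion_def sum_distrib_left mult.assoc)

lemma bernstein_coeff_shifted_cube:
  assumes "N \<ge> 3" "k \<le> N"
  shows "bernstein_coeff N (\<lambda>x. (x - a) ^ 3) k =
    real (k choose 3) / real (N choose 3) - 3 * a * (real (k choose 2) / real (N choose 2))
      + 3 * a\<^sup>2 * (real k / real N) - a ^ 3"
proof -
  let ?c = "\<lambda>j k. real (k choose j) / real (N choose j)"
  have "bernstein_expansion N
      (\<lambda>x. x ^ 3 + (- 3 * a * x ^ 2 + (3 * a\<^sup>2 * x ^ 1 + (- (a ^ 3)) * x ^ 0)))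
      (\<lambda>k. ?c 3 k + (- 3 * a * ?c 2 k + (3 * a\<^sup>2 * ?c 1 k + (- (a ^ 3)) * ?c 0 k)))"
    using assms(1)
    by (intro bernstein_expansion_add bernstein_expansion_scale bernstein_expansion_power) auto
  moreover have "(\<lambda>x. x ^ 3 + (- 3 * a * x ^ 2 + (3 * a\<^sup>2 * x ^ 1 + (- (a ^ 3)) * x ^ 0)))
      = (\<lambda>x. (x - a) ^ 3)"
    by (simp add: fun_eq_iff power3_eq_cube power2_eq_square algebra_simps)
  ultimately show ?thesis
    using bernstein_coeff_eqI[OF _ assms(2)] by fastforce
qed

lemma bernstein_coeff_2_less:
  assumes "N \<ge> 3"
  shows "bernstein_coeff N (\<lambda>x. (x - 1 / real N) ^ 3) 2 < - ((1 / real N) ^ 3)"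
proof -
  let ?n = "real N"
  have n: "?n \<ge> 3" using assms by simp
  have N2: "real (N choose 2) = ?n * (?n - 1) / 2"
    using assms by (simp add: choose_two real_of_nat_div of_nat_diff)
  have "bernstein_coeff N (\<lambda>x. (x - 1 / ?n) ^ 3) 2
      = - 3 * (1 / ?n) * (1 / (?n * (?n - 1) / 2)) + 3 * (1 / ?n)\<^sup>2 * (2 / ?n) - (1 / ?n) ^ 3"
    using assms by (simp add: bernstein_coeff_shifted_cube N2 binomial_eq_0)
  also have "\<dots> = - ((1 / ?n) ^ 3) * ((?n + 5) / (?n - 1))"
    using n by (simp add: divide_simps power3_eq_cube power2_eq_square)
  also have "\<dots> < - ((1 / ?n) ^ 3) * 1"
    using n by (intro mult_strict_left_mono_neg) (auto simp: field_simps)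
  finally show ?thesis by simp
qed

lemma generalized_bernstein_operator_nodes:
  assumes "generalized_bernstein_operator N B" "fixes_function B (\<lambda>x. 1)" "fixes_function B g"
    and "continuous_on {0..1} g"
  obtains t where "\<And>k. k \<le> N \<Longrightarrow> t k \<in> {0..1}" "\<And>k. k \<le> N \<Longrightarrow> g (t k) = bernstein_coeff N g k"
proof -
  obtain t \<alpha> where t: "\<And>k. k \<le> N \<Longrightarrow> t k \<in> {0..1}"
    and B: "\<And>f x. continuous_on {0..1} f \<Longrightarrow> x \<in> {0..1} \<Longrightarrow>
              B f x = (\<Sum>k\<le>N. f (t k) * \<alpha> k * Bernstein N k x)"
    using assms(1) unfolding generalized_bernstein_operator_def by blast
  have coeff: "bernstein_coeff N f k = f (t k) * \<alpha> k"
    if "continuous_on {0..1} f" "fixes_function B f" "k \<le> N" for f k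
    using that B[OF that(1)]
    by (intro bernstein_coeff_eqI) (auto simp: bernstein_expansion_def fixes_function_def)
  have "\<alpha> k = 1" if "k \<le> N" for k
    using coeff[of "\<lambda>x. 1" k] bernstein_coeff_eqI[OF bernstein_expansion_power[of 0 N] that]
      assms(2) that by simp
  then show thesis
    using that[of t] t coeff[OF assms(4,3)] by simp
qed

theorem theorem5p3:
  fixes N :: nat and f1 :: "real \<Rightarrow> real" and \<gamma> :: "nat \<Rightarrow> real" and t2 :: real
  assumes "N \<ge> 3"
    and "f1 = (\<lambda>x. (x - 1 / real N) ^ 3)"
    and "\<gamma> = bernstein_coeff N f1"
    and "t2 = 1 / real N + root 3 (\<gamma> 2)"
  shows "t2 < 0 \<and>
    \<not> (\<exists>B. generalized_bernstein_operator N B \<and>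
           fixes_function B (\<lambda>x. 1) \<and> fixes_function B f1)"
proof
  have less: "\<gamma> 2 < (- (1 / real N)) ^ 3"
    using bernstein_coeff_2_less[OF assms(1)] assms(2,3) by simp
  then have "root 3 (\<gamma> 2) < root 3 ((- (1 / real N)) ^ 3)"
    by simp
  also have "\<dots> = - (1 / real N)"
    by (rule odd_real_root_power_cancel) simp
  finally show "t2 < 0"
    using assms(4) by simp
  show "\<not> (\<exists>B. generalized_bernstein_operator N B \<and>
           fixes_function B (\<lambda>x. 1) \<and> fixes_function B f1)"
  proof
    assume "\<exists>B. generalized_bernstein_operator N B \<and>
           fixes_function B (\<lambda>x. 1) \<and> fixes_function B f1"
    moreover have "continuous_on {0..1} f1"
      unfolding assms(2) by (intro continuous_intros)
    ultimately obtain t where t: "\<And>k. k \<le> N \<Longrightarrow> t k \<in> {0..1}"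
      "\<And>k. k \<le> N \<Longrightarrow> f1 (t k) = \<gamma> k"
      using generalized_bernstein_operator_nodes assms(3) by metis
    have "(- (1 / real N)) ^ 3 \<le> (t 2 - 1 / real N) ^ 3"
      using t(1)[of 2] assms(1) by (intro power_mono_odd) auto
    with less t(2)[of 2] assms(1,2) show False
      by simp
  qed
qed

end
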